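(* Let $\mathcal{H}$ be a complex Hilbert space, $A\in\mathcal{B}(\mathcal{H})$ a positive operator, $d\ge1$ an integer, and let $(T_1,\dots,T_d)\in\mathcal{B}_{A^{1/2}}(\mathcal{H})^d$ and $(S_1,\dots,S_d)\in\mathcal{B}_{A^{1/2}}(\mathcal{H})^d$. Then $$r_A\left(\sum_{k=1}^dT_kS_k\right)\leq\max_{1\leq i\leq d}\left\{\omega_A(S_iT_i)+\frac12\sum_{j=1,\,j\neq i}^d\left(\|S_iT_j\|_A+\|S_jT_i\|_A\right)\right\}.$$
   Context: $\mathcal{B}(\mathcal{H})$ is the algebra of bounded linear operators on the complex Hilbert space $(\mathcal{H},\langle\cdot\mid\cdot\rangle)$. For positive $A$, put $\langle x\mid y\rangle_A=\langle Ax\mid y\rangle$ and $\|x\|_A=\langle x\mid x\rangle_A^{1/2}=\|A^{1/2}x\|$. $\mathcal{B}_{A^{1/2}}(\mathcal{H})$ is the set of $T\in\mathcal{B}(\mathcal{H})$ for which there is $\lambda>0$ with $\|Tx\|_A\le\lambda\|x\|_A$ for all $x\in\mathcal{H}$ ($A$-bounded operators). For such $T$, $\|T\|_A=\sup\{\|Tx\|_A: x\in\mathcal{H},\ \|x\|_A=1\}$, the $A$-numerical radius is $\omega_A(T)=\sup\{|\langle Tx\mid x\rangle_A|: x\in\mathcal{H},\ \|x\|_A=1\}$ (suprema over the empty set, occurring only if $A=0$, are $0$), and the $A$-spectral radius is $r_A(T)=\inf_{n\ge1}\|T^n\|_A^{1/n}=\lim_{n\to\infty}\|T^n\|_A^{1/n}$.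 *)

theory Defs
  imports "HOL-Analysis.Analysis"
begin

text \<open>
  A complex Hilbert space: a complete real inner product space with a compatible complex scalar
  multiplication and a sesquilinear form (linear in its first argument) whose real part is the
  underlying real inner product. Positive definiteness of the form is thus inherited from
  \<^class>\<open>real_inner\<close>, and the norm is the square root of \<^term>\<open>Re\<close> of the form at \<open>(x, x)\<close>.
\<close>

class complex_hilbert_space = real_inner + banach +
  fixes scaleC :: "complex \<Rightarrow> 'a \<Rightarrow> 'a"  (infixr \<open>*\<^sub>C\<close> 75)
    and cinner :: "'a \<Rightarrow> 'a \<Rightarrow> complex"
  assumes scaleC_add_right: "a *\<^sub>C (x + y) = a *\<^sub>C x + a *\<^sub>C y"
    and scaleC_add_left: "(a + b) *\<^sub>C x = a *\<^sub>C x + b *\<^sub>C x"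
    and scaleC_scaleC: "a *\<^sub>C (b *\<^sub>C x) = (a * b) *\<^sub>C x"
    and scaleC_of_real: "of_real r *\<^sub>C x = r *\<^sub>R x"
    and cinner_add_left: "cinner (x + y) z = cinner x z + cinner y z"
    and cinner_scaleC_left: "cinner (a *\<^sub>C x) y = a * cinner x y"
    and cinner_commute: "cinner x y = cnj (cinner y x)"
    and Re_cinner: "Re (cinner x y) = inner x y"

instantiation complex :: complex_hilbert_space
begin

definition scaleC_complex :: "complex \<Rightarrow> complex \<Rightarrow> complex"
  where "scaleC_complex a x = a * x"

definition cinner_complex :: "complex \<Rightarrow> complex \<Rightarrow> complex"
  where "cinner_complex x y = x * cnj y"

instance
  by standard
    (simp_all add: scaleC_complex_def cinner_complex_def algebra_simps inner_complex_def
      scaleR_conv_of_real)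

end

definition bounded_clinear :: "('a::complex_hilbert_space \<Rightarrow> 'a) \<Rightarrow> bool"
  where "bounded_clinear T \<longleftrightarrow> bounded_linear T \<and> (\<forall>c x. T (c *\<^sub>C x) = c *\<^sub>C T x)"

definition positive_operator :: "('a::complex_hilbert_space \<Rightarrow> 'a) \<Rightarrow> bool"
  where "positive_operator A \<longleftrightarrow>
    bounded_clinear A \<and> (\<forall>x. cinner (A x) x \<in> \<real>\<^sub>\<ge>\<^sub>0)"

definition A_inner :: "('a::complex_hilbert_space \<Rightarrow> 'a) \<Rightarrow> 'a \<Rightarrow> 'a \<Rightarrow> complex"
  where "A_inner A x y = cinner (A x) y"

text \<open>For positive \<open>A\<close> the number \<open>A_inner A x x\<close> is real, so \<^term>\<open>Re\<close> is a mere coercion.\<close>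

definition A_seminorm :: "('a::complex_hilbert_space \<Rightarrow> 'a) \<Rightarrow> 'a \<Rightarrow> real"
  where "A_seminorm A x = sqrt (Re (A_inner A x x))"

definition A_bounded_operators ::
    "('a::complex_hilbert_space \<Rightarrow> 'a) \<Rightarrow> ('a \<Rightarrow> 'a) set"
  where "A_bounded_operators A =
    {T. bounded_clinear T \<and> (\<exists>c>0. \<forall>x. A_seminorm A (T x) \<le> c * A_seminorm A x)}"

text \<open>\<^term>\<open>Sup ({} :: real set)\<close> is unspecified; suprema over the empty set are set to \<open>0\<close>.\<close>

definition Sup0 :: "real set \<Rightarrow> real"
  where "Sup0 X = (if X = {} then 0 else Sup X)"

definition A_opnorm :: "('a::complex_hilbert_space \<Rightarrow> 'a) \<Rightarrow> ('a \<Rightarrow> 'a) \<Rightarrow> real"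
  where "A_opnorm A T = Sup0 {A_seminorm A (T x) | x. A_seminorm A x = 1}"

definition A_numerical_radius ::
    "('a::complex_hilbert_space \<Rightarrow> 'a) \<Rightarrow> ('a \<Rightarrow> 'a) \<Rightarrow> real"
  where "A_numerical_radius A T = Sup0 {cmod (A_inner A (T x) x) | x. A_seminorm A x = 1}"

definition A_spectral_radius ::
    "('a::complex_hilbert_space \<Rightarrow> 'a) \<Rightarrow> ('a \<Rightarrow> 'a) \<Rightarrow> real"
  where "A_spectral_radius A T = (INF n\<in>{1..}. root n (A_opnorm A (T ^^ n)))"

end

theory Submission
  imports Defs "HOL-Library.Function_Algebras"
begin

text \<open>
  With \<open>s x = (S\<^sub>i x)\<^sub>i\<close> and \<open>t u = \<Sum>\<^sub>j T\<^sub>j u\<^sub>j\<close>, the operator \<open>\<Sum>\<^sub>k T\<^sub>k S\<^sub>k\<close> is \<open>t \<circ> s\<close>, and its powers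
  \<open>t \<circ> (s \<circ> t)\<^sup>n \<circ> s\<close> grow no faster than those of the operator matrix \<open>s \<circ> t = (S\<^sub>i T\<^sub>j)\<^sub>i\<^sub>j\<close> on the
  direct sum. By \<open>2ab \<le> a\<^sup>2 + b\<^sup>2\<close>, the right-hand side of the theorem bounds the numerical radius of
  this matrix. Powers of an operator \<open>B\<close> with numerical radius at most \<open>w\<close> satisfy
  \<open>\<parallel>B\<^sup>n x\<parallel> \<le> 2 w\<^sup>n \<parallel>x\<parallel>\<close>, by Berger's power inequality and polarization, so \<open>n\<close>-th roots finish
  the proof. The form is allowed to be degenerate throughout, so no quotient by the null space of
  \<open>A\<close> is needed.
\<close>

section \<open>Semi-inner product spaces\<close>

locale complex_semi_inner = module scale
  for scale :: "complex \<Rightarrow> 'b::ab_group_add \<Rightarrow> 'b" +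
  fixes form :: "'b \<Rightarrow> 'b \<Rightarrow> complex"
  assumes form_add_left: "form (x + y) z = form x z + form y z"
    and form_add_right: "form z (x + y) = form z x + form z y"
    and form_scale_left: "form (scale a x) y = a * form x y"
    and form_scale_right: "form x (scale a y) = cnj a * form x y"
    and form_nonneg: "form x x \<in> \<real>\<^sub>\<ge>\<^sub>0"
begin

definition snorm :: "'b \<Rightarrow> real"
  where "snorm x = sqrt (Re (form x x))"

lemma Re_form_nonneg: "0 \<le> Re (form x x)"
  and Im_form: "Im (form x x) = 0"
  using form_nonneg[of x] by (auto simp: complex_nonneg_Reals_iff)

lemma snorm_nonneg [simp]: "0 \<le> snorm x"
  by (simp add: snorm_def Re_form_nonneg)

lemma snorm_power2: "(snorm x)\<^sup>2 = Re (form x x)"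
  by (simp add: snorm_def Re_form_nonneg)

lemma form_self: "form x x = of_real ((snorm x)\<^sup>2)"
  by (simp add: complex_eq_iff snorm_power2 Im_form)

lemma form_minus_left: "form (- x) y = - form x y"
  using form_scale_left[of "-1" x y] by simp

lemma form_minus_right: "form x (- y) = - form x y"
  using form_scale_right[of x "-1" y] by simp

lemma form_diff_left: "form (x - y) z = form x z - form y z"
  using form_add_left[of x "- y" z] by (simp add: form_minus_left)

lemma form_diff_right: "form z (x - y) = form z x - form z y"
  using form_add_right[of z x "- y"] by (simp add: form_minus_right)

lemma form_zero_right: "form x 0 = 0"
  using form_diff_right[of x 0 0] by simp

lemma form_zero_left: "form 0 x = 0"
  using form_diff_left[of 0 0 x] by simp

lemma form_sum_right: "form x (sum f I) = (\<Sum>i\<in>I. form x (f i))"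
  by (induction I rule: infinite_finite_induct) (simp_all add: form_zero_right form_add_right)

lemma form_sum_left: "form (sum f I) x = (\<Sum>i\<in>I. form (f i) x)"
  by (induction I rule: infinite_finite_induct) (simp_all add: form_zero_left form_add_left)

text \<open>Symmetry is not a locale axiom; it follows by expanding the real diagonal values at
  \<open>x + y\<close> and \<open>x + scale \<i> y\<close>.\<close>

lemma form_commute: "form x y = cnj (form y x)"
proof -
  have "Im (form x y + form y x) = 0"
    using Im_form[of "x + y"] by (simp add: form_add_left form_add_right Im_form)
  moreover have "Re (form x y) = Re (form y x)"
    using Im_form[of "x + scale \<i> y"]
    by (simp add: form_add_left form_add_right form_scale_left form_scale_right Im_form)
  ultimately show ?thesis by (simp add: complex_eq_iff)
qed

text \<open>One expansion serves three ends: Cauchy-Schwarz through a suitable \<open>c\<close>, the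
  triangle inequality at \<open>c = -1\<close>, and polarization at the fourth roots of
  unity.\<close>

lemma snorm_diff_scale:
  "(snorm (x - scale c y))\<^sup>2 = (snorm x)\<^sup>2 - 2 * Re (cnj c * form x y) + (cmod c)\<^sup>2 * (snorm y)\<^sup>2"
proof -
  have "form (x - scale c y) (x - scale c y)
      = form x x - (cnj c * form x y + cnj (cnj c * form x y)) + c * cnj c * form y y"
    using form_commute[of y x]
    by (simp add: form_diff_left form_diff_right form_scale_left form_scale_right algebra_simps)
  also have "\<dots> = of_real ((snorm x)\<^sup>2) - of_real (2 * Re (cnj c * form x y))
      + of_real ((cmod c)\<^sup>2) * of_real ((snorm y)\<^sup>2)"
    by (simp only: complex_add_cnj form_self complex_norm_square)
  finally have "form (x - scale c y) (x - scale c y)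
      = of_real ((snorm x)\<^sup>2 - 2 * Re (cnj c * form x y) + (cmod c)\<^sup>2 * (snorm y)\<^sup>2)"
    by (simp only: of_real_add of_real_diff of_real_mult)
  then show ?thesis
    by (simp add: snorm_power2)
qed

lemma snorm_scale: "snorm (scale c x) = cmod c * snorm x"
proof -
  have "form (scale c x) (scale c x) = of_real ((cmod c * snorm x)\<^sup>2)"
    using complex_norm_square[of c]
    by (simp add: form_scale_left form_scale_right form_self[of x] power_mult_distrib mult_ac)
  then have "(snorm (scale c x))\<^sup>2 = (cmod c * snorm x)\<^sup>2"
    by (simp only: snorm_power2 Re_complex_of_real)
  then show ?thesis by simp
qed

section \<open>Inequalities for a possibly degenerate form\<close>

lemma cauchy_schwarz: "cmod (form x y) \<le> snorm x * snorm y"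
proof (cases "snorm y = 0")
  case True
  have "cmod (form x y) = 0"
  proof (rule ccontr)
    assume nz: "cmod (form x y) \<noteq> 0"
    \<comment> \<open>With this \<open>t\<close> the squared seminorm of
      \<open>x - scale (of_real t * form x y) y\<close> would be \<open>-1\<close>, since the
      quadratic term vanishes with \<open>snorm y\<close>.\<close>
    define t where "t = ((snorm x)\<^sup>2 + 1) / (2 * (cmod (form x y))\<^sup>2)"
    have "cnj (of_real t * form x y) * form x y = of_real (t * (cmod (form x y))\<^sup>2)"
      using complex_norm_square[of "form x y"] by (simp add: mult_ac)
    then have "0 \<le> (snorm x)\<^sup>2 - 2 * (t * (cmod (form x y))\<^sup>2)"
      using snorm_diff_scale[of x "of_real t * form x y" y] True
      by (metis (no_types, lifting) Re_complex_of_real add.right_neutral mult_zero_right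
          power_zero_numeral zero_le_power2)
    moreover have "2 * (t * (cmod (form x y))\<^sup>2) = (snorm x)\<^sup>2 + 1"
      using nz by (simp add: t_def)
    ultimately show False by simp
  qed
  then show ?thesis by simp
next
  case False
  define N where "N = (snorm y)\<^sup>2"
  have N: "N > 0" using False by (simp add: N_def)
  \<comment> \<open>The coefficient \<open>form x y / of_real N\<close> is that of the projection of
    \<open>x\<close> onto \<open>y\<close>, which minimizes the expanded square.\<close>
  have "cnj (form x y / of_real N) * form x y = of_real ((cmod (form x y))\<^sup>2 / N)"
    using complex_norm_square[of "form x y"] by (simp add: mult_ac)
  then have "0 \<le> (snorm x)\<^sup>2 - 2 * ((cmod (form x y))\<^sup>2 / N) + (cmod (form x y) / N)\<^sup>2 * N"
    using snorm_diff_scale[of x "form x y / of_real N" y] N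
    by (metis N_def Re_complex_of_real abs_of_pos norm_divide norm_of_real zero_le_power2)
  also have "\<dots> = (snorm x)\<^sup>2 - (cmod (form x y))\<^sup>2 / N"
    using N by (simp add: field_simps power2_eq_square)
  finally have "(cmod (form x y))\<^sup>2 \<le> (snorm x * snorm y)\<^sup>2"
    using N by (simp add: field_simps power_mult_distrib N_def)
  then show ?thesis by (rule power2_le_imp_le) simp
qed

lemma snorm_triangle: "snorm (x + y) \<le> snorm x + snorm y"
proof (rule power2_le_imp_le)
  have "(snorm (x + y))\<^sup>2 = (snorm x)\<^sup>2 + 2 * Re (form x y) + (snorm y)\<^sup>2"
    using snorm_diff_scale[of x "-1" y] by simp
  also have "\<dots> \<le> (snorm x)\<^sup>2 + 2 * (snorm x * snorm y) + (snorm y)\<^sup>2"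
    using complex_Re_le_cmod[of "form x y"] cauchy_schwarz[of x y] by simp
  finally show "(snorm (x + y))\<^sup>2 \<le> (snorm x + snorm y)\<^sup>2"
    by (simp add: power2_sum)
qed simp

lemma snorm_zero: "snorm 0 = 0"
  by (simp add: snorm_def form_zero_left)

lemma snorm_sum: "snorm (sum f I) \<le> (\<Sum>i\<in>I. snorm (f i))"
proof (induction I rule: infinite_finite_induct)
  case (insert i I)
  then show ?case using snorm_triangle[of "f i" "sum f I"] by simp
qed (simp_all add: snorm_zero)

text \<open>
  Pearcy's proof of the power inequality: if \<open>\<omega>\<close> is a primitive \<open>n\<close>-th root of unity, the vectors
  \<open>v j = \<Sum>\<^sub>k\<^sub><\<^sub>n (c \<omega>\<^sup>j B)\<^sup>k x\<close> have average \<open>x\<close>, while \<open>v j - c \<omega>\<^sup>j B (v j)\<close> does not depend on \<open>j\<close>.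
\<close>

lemma power_inequality_aux:
  assumes B: "module_hom scale scale B"
    and n: "n > 0"
    and num: "\<And>y. cmod (c * form (B y) y) \<le> (snorm y)\<^sup>2"
  shows "Re (c ^ n * form ((B ^^ n) x) x) \<le> (snorm x)\<^sup>2"
proof -
  interpret B: module_hom scale scale B by (fact B)
  define \<omega> where "\<omega> = cis (2 * pi / n)"
  have \<omega>_power: "\<omega> ^ k = 1 \<longleftrightarrow> n dvd k" for k
  proof -
    have "\<omega> ^ k = exp (2 * of_real pi * \<i> * of_nat k / of_nat n)"
      unfolding \<omega>_def Complex.DeMoivre unfolding cis_conv_exp
      by (rule arg_cong[where f = exp]) simp
    then show ?thesis using complex_root_unity_eq_1[of n k] n by simp
  qed
  define v where "v j = (\<Sum>k<n. scale ((c * \<omega> ^ j) ^ k) ((B ^^ k) x))" for j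
  define z where "z = x - scale (c ^ n) ((B ^^ n) x)"
  have telescope: "v j - scale (c * \<omega> ^ j) (B (v j)) = z" for j
  proof -
    let ?a = "c * \<omega> ^ j"
    have "v j - scale ?a (B (v j))
        = (\<Sum>k<n. scale (?a ^ k) ((B ^^ k) x) - scale (?a ^ Suc k) ((B ^^ Suc k) x))"
      by (simp add: v_def B.sum B.scale scale_sum_right sum_subtractf)
    also have "\<dots> = x - scale (?a ^ n) ((B ^^ n) x)"
      by (subst sum_lessThan_telescope') simp
    also have "?a ^ n = c ^ n"
      using \<omega>_power[of "j * n"] by (simp add: power_mult_distrib power_mult)
    finally show ?thesis by (simp add: z_def)
  qed
  have average: "(\<Sum>j<n. v j) = scale (of_nat n) x"
  proof -
    \<comment> \<open>For \<open>0 < k < n\<close> the number \<open>\<omega> ^ k\<close> is a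
      nontrivial \<open>n\<close>-th root of unity, so its geometric sum vanishes.\<close>
    have roots: "(\<Sum>j<n. (c * \<omega> ^ j) ^ k) = (if k = 0 then of_nat n else 0)" if "k < n" for k
    proof (cases "k = 0")
      case False
      have "\<omega> ^ k \<noteq> 1" using False that by (auto simp: \<omega>_power dest: dvd_imp_le)
      moreover have "(\<omega> ^ k) ^ n = 1" using \<omega>_power[of "k * n"] by (simp add: power_mult)
      ultimately have "(\<Sum>j<n. (\<omega> ^ k) ^ j) = 0" by (simp add: geometric_sum)
      then show ?thesis using False
        by (simp add: power_mult_distrib power_mult[symmetric] mult.commute
            sum_distrib_left[symmetric])
    qed simp
    have "(\<Sum>j<n. v j) = (\<Sum>k<n. scale (\<Sum>j<n. (c * \<omega> ^ j) ^ k) ((B ^^ k) x))"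
      unfolding v_def by (subst sum.swap) (simp add: scale_sum_left)
    also have "\<dots> = (\<Sum>k<n. if k = 0 then scale (of_nat n) x else 0)"
      by (intro sum.cong) (auto simp: roots)
    finally show ?thesis using n by simp
  qed
  \<comment> \<open>The unimodular factor \<open>\<omega> ^ j\<close> leaves the bound
    \<open>num\<close> intact, and \<open>z\<close> may be written through any
    \<open>v j\<close>.\<close>
  have "0 \<le> Re (form z (v j))" for j
  proof -
    have "cmod (c * \<omega> ^ j * form (B (v j)) (v j)) \<le> (snorm (v j))\<^sup>2"
      using num[of "v j"] by (simp add: norm_mult norm_power \<omega>_def)
    then have "Re (c * \<omega> ^ j * form (B (v j)) (v j)) \<le> (snorm (v j))\<^sup>2"
      using complex_Re_le_cmod order_trans by blast
    moreover have "form z (v j) = form (v j) (v j) - c * \<omega> ^ j * form (B (v j)) (v j)"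
      by (subst telescope[of j, symmetric]) (simp only: form_diff_left form_scale_left)
    ultimately show ?thesis by (simp add: snorm_power2)
  qed
  \<comment> \<open>As \<open>z\<close> is the same for all \<open>j\<close>, the sum passes to the
    second argument, where the \<open>v j\<close> add up to \<open>n\<close> times
    \<open>x\<close>.\<close>
  then have "0 \<le> (\<Sum>j<n. Re (form z (v j)))" by (intro sum_nonneg)
  also have "\<dots> = n * Re (form z x)"
    by (simp flip: Re_sum form_sum_right add: average form_scale_right)
  finally have "0 \<le> Re (form z x)" using n by (simp add: zero_le_mult_iff)
  then show ?thesis
    by (simp add: z_def form_diff_left form_scale_left snorm_power2)
qed

theorem power_inequality:
  assumes B: "module_hom scale scale B"
    and w: "w > 0"
    and num: "\<And>y. cmod (form (B y) y) \<le> w * (snorm y)\<^sup>2"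
  shows "cmod (form ((B ^^ n) x) x) \<le> w ^ n * (snorm x)\<^sup>2"
proof (cases "n = 0")
  case True
  then show ?thesis by (simp add: form_self norm_power)
next
  case False
  define f where "f = form ((B ^^ n) x) x"
  \<comment> \<open>Modulus \<open>1 / w\<close> turns the hypothesis into that of
    \<open>power_inequality_aux\<close>; the argument makes \<open>c ^ n\<close> rotate
    \<open>f\<close> onto the nonnegative real axis.\<close>
  define c where "c = rcis (1 / w) (- Arg f / n)"
  have "cmod (c * form (B y) y) \<le> (snorm y)\<^sup>2" for y
    using num[of y] w by (simp add: c_def norm_mult field_simps)
  then have "Re (c ^ n * f) \<le> (snorm x)\<^sup>2"
    unfolding f_def using False by (intro power_inequality_aux B) auto
  moreover have "c ^ n * f = of_real (cmod f / w ^ n)"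
  proof -
    have "c ^ n * f = rcis ((1 / w) ^ n) (- Arg f) * rcis (cmod f) (Arg f)"
      unfolding c_def using False by (simp add: DeMoivre2 rcis_cmod_Arg)
    also have "\<dots> = rcis (cmod f / w ^ n) 0"
      by (simp add: rcis_mult power_divide)
    finally show ?thesis by simp
  qed
  ultimately have "cmod f / w ^ n \<le> (snorm x)\<^sup>2" by simp
  then show ?thesis using w by (simp add: f_def field_simps)
qed

text \<open>Polarization recovers the whole form from its diagonal values, at the cost of the factor
  2.\<close>

lemma snorm_le_numerical_bound:
  assumes B: "module_hom scale scale B"
    and w: "w > 0"
    and num: "\<And>y. cmod (form (B y) y) \<le> w * (snorm y)\<^sup>2"
  shows "snorm (B x) \<le> 2 * w * snorm x"
proof -
  interpret B: module_hom scale scale B by (fact B)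
  have polar: "cmod (form (B x) y) \<le> w * ((snorm x)\<^sup>2 + (snorm y)\<^sup>2)" for y
  proof -
    let ?q = "\<lambda>c. form (B (x - scale c y)) (x - scale c y)"
    have "4 * form (B x) y = - ?q 1 + ?q (-1) - \<i> * ?q \<i> + \<i> * ?q (-\<i>)"
      by (simp add: B.diff B.scale B.add B.neg form_diff_left form_diff_right form_scale_left
          form_scale_right form_add_left form_add_right form_minus_left form_minus_right algebra_simps)
    also have "cmod \<dots> \<le> cmod (?q 1) + cmod (?q (-1)) + cmod (?q \<i>) + cmod (?q (-\<i>))"
    proof -
      have "cmod (- a + b - \<i> * c + \<i> * e) \<le> cmod a + cmod b + cmod c + cmod e" for a b c e
        by (intro order_trans[OF norm_triangle_ineq] order_trans[OF norm_triangle_ineq4] add_mono)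
          (simp_all add: norm_mult)
      then show ?thesis .
    qed
    also have "\<dots> \<le> w * ((snorm (x - scale 1 y))\<^sup>2 + (snorm (x - scale (-1) y))\<^sup>2
        + (snorm (x - scale \<i> y))\<^sup>2 + (snorm (x - scale (-\<i>) y))\<^sup>2)"
      unfolding distrib_left by (intro add_mono num)
    \<comment> \<open>The cross terms cancel over the four roots of unity.\<close>
    also have "\<dots> = 4 * (w * ((snorm x)\<^sup>2 + (snorm y)\<^sup>2))"
      unfolding snorm_diff_scale by (simp add: algebra_simps)
    finally show ?thesis by (simp add: norm_mult)
  qed
  \<comment> \<open>For the multiple \<open>1 / (2 * w)\<close> of \<open>B x\<close> the last term
    on the right is half of the left-hand side and can be absorbed.\<close>
  have "(snorm (B x))\<^sup>2 / (2 * w) \<le> w * ((snorm x)\<^sup>2 + (snorm (B x) / (2 * w))\<^sup>2)"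
    using polar[of "scale (of_real (1 / (2 * w))) (B x)"] w
    by (simp add: form_scale_right form_self snorm_scale norm_mult norm_power norm_divide)
  then have "(snorm (B x))\<^sup>2 \<le> (2 * w * snorm x)\<^sup>2"
    using w by (simp add: field_simps power2_eq_square)
  then show ?thesis by (rule power2_le_imp_le) (use w in simp)
qed

lemma module_hom_funpow: "module_hom scale scale B \<Longrightarrow> module_hom scale scale (B ^^ n)"
proof (induction n)
  case 0
  then show ?case using module_hom_ident by (simp add: id_def)
next
  case (Suc n)
  then show ?case by (simp add: module_hom_iff)
qed

text \<open>The power inequality is applied before polarization, so the factor 2 is paid once and
  not at each of the \<open>n\<close> steps.\<close>

lemma snorm_funpow_le:
  assumes "module_hom scale scale B" and "w > 0"
    and "\<And>y. cmod (form (B y) y) \<le> w * (snorm y)\<^sup>2"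
  shows "snorm ((B ^^ n) x) \<le> 2 * w ^ n * snorm x"
  using assms by (intro snorm_le_numerical_bound module_hom_funpow power_inequality) auto

end


section \<open>The form of a positive operator\<close>

lemma module_scaleC: "module (scaleC :: complex \<Rightarrow> 'a::complex_hilbert_space \<Rightarrow> 'a)"
proof
  show "1 *\<^sub>C x = x" for x :: 'a
    using scaleC_of_real[of 1 x] by simp
qed (simp_all add: scaleC_add_right scaleC_add_left scaleC_scaleC)

lemma complex_semi_inner_A_inner:
  assumes "positive_operator A"
  shows "complex_semi_inner scaleC (A_inner A)"
proof -
  have lin: "bounded_linear A" and scale: "A (c *\<^sub>C x) = c *\<^sub>C A x"
    and pos: "cinner (A x) x \<in> \<real>\<^sub>\<ge>\<^sub>0" for c x
    using assms by (auto simp: positive_operator_def bounded_clinear_def)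
  have add_right: "cinner x (y + z) = cinner x y + cinner x z" for x y z :: 'a
    by (metis cinner_add_left cinner_commute complex_cnj_add)
  have scale_right: "cinner x (c *\<^sub>C y) = cnj c * cinner x y" for c and x y :: 'a
    by (metis cinner_scaleC_left cinner_commute complex_cnj_mult)
  show ?thesis
    by (intro complex_semi_inner.intro module_scaleC complex_semi_inner_axioms.intro)
      (simp_all add: A_inner_def cinner_add_left cinner_scaleC_left add_right scale_right scale pos
        linear_add[OF bounded_linear.linear[OF lin]])
qed

locale positive_form =
  fixes A :: "'a::complex_hilbert_space \<Rightarrow> 'a"
  assumes positive: "positive_operator A"
begin

sublocale complex_semi_inner scaleC "A_inner A"
  by (rule complex_semi_inner_A_inner[OF positive])

lemma A_seminorm_eq: "A_seminorm A = snorm"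
  by (simp add: fun_eq_iff A_seminorm_def snorm_def)

lemma A_bounded_module_hom:
  "B \<in> A_bounded_operators A \<Longrightarrow> module_hom scaleC scaleC B"
  by (auto simp: A_bounded_operators_def bounded_clinear_def module_hom_iff module_scaleC
      linear_add dest: bounded_linear.linear)

lemma A_bounded_compose:
  assumes "B \<in> A_bounded_operators A" and "C \<in> A_bounded_operators A"
  shows "B \<circ> C \<in> A_bounded_operators A"
proof -
  obtain b c where bc: "b > 0" "c > 0" "\<And>x. snorm (B x) \<le> b * snorm x" "\<And>x. snorm (C x) \<le> c * snorm x"
    using assms by (auto simp: A_bounded_operators_def A_seminorm_eq)
  have "snorm (B (C x)) \<le> b * c * snorm x" for x
    using order_trans[OF bc(3)[of "C x"] mult_left_mono[OF bc(4)[of x]]] bc(1) by simp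
  then have "\<exists>c>0. \<forall>x. snorm ((B \<circ> C) x) \<le> c * snorm x"
    using bc(1,2) by (intro exI[of _ "b * c"]) simp
  moreover have "bounded_linear (B \<circ> C)"
    using assms by (auto simp: A_bounded_operators_def bounded_clinear_def o_def
        intro: bounded_linear_compose)
  ultimately show ?thesis
    using assms by (simp add: A_bounded_operators_def bounded_clinear_def A_seminorm_eq)
qed

section \<open>Finite suprema and the pointwise estimates drawn from them\<close>

lemma bdd_above_snorm_values:
  assumes "B \<in> A_bounded_operators A"
  shows "bdd_above {snorm (B x) | x. snorm x = 1}"
proof -
  obtain c where "\<And>x. snorm (B x) \<le> c * snorm x"
    using assms by (auto simp: A_bounded_operators_def A_seminorm_eq)
  then have "snorm (B x) \<le> c" if "snorm x = 1" for x
    using that by (metis mult.right_neutral)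
  then show ?thesis by (auto intro: bdd_aboveI[of _ c])
qed

lemma bdd_above_form_values:
  assumes "B \<in> A_bounded_operators A"
  shows "bdd_above {cmod (A_inner A (B x) x) | x. snorm x = 1}"
proof -
  obtain c where "\<And>x. snorm (B x) \<le> c * snorm x"
    using assms by (auto simp: A_bounded_operators_def A_seminorm_eq)
  then have "cmod (A_inner A (B x) x) \<le> c" if "snorm x = 1" for x
    using cauchy_schwarz[of "B x" x] that by (metis mult.right_neutral order_trans)
  then show ?thesis by (auto intro: bdd_aboveI[of _ c])
qed

lemma snorm_normalize:
  assumes "snorm x \<noteq> 0"
  shows "snorm (of_real (1 / snorm x) *\<^sub>C x) = 1"
  using assms by (simp add: snorm_scale norm_divide)

lemma snorm_le_A_opnorm:
  assumes B: "B \<in> A_bounded_operators A"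
  shows "snorm (B x) \<le> A_opnorm A B * snorm x"
proof (cases "snorm x = 0")
  \<comment> \<open>A null vector cannot be normalized; \<open>A\<close>-boundedness makes
    \<open>B x\<close> null as well.\<close>
  case True
  obtain c where "snorm (B x) \<le> c * snorm x"
    using B by (auto simp: A_bounded_operators_def A_seminorm_eq)
  then show ?thesis using True by simp
next
  case False
  interpret B: module_hom scaleC scaleC B by (rule A_bounded_module_hom[OF B])
  let ?u = "of_real (1 / snorm x) *\<^sub>C x"
  have "snorm (B ?u) \<in> {snorm (B x) | x. snorm x = 1}"
    using snorm_normalize[OF False] by blast
  then have "snorm (B ?u) \<le> A_opnorm A B"
    using bdd_above_snorm_values[OF B]
    by (auto simp: A_opnorm_def Sup0_def A_seminorm_eq intro!: cSup_upper)
  then show ?thesis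
    using False by (simp add: B.scale snorm_scale norm_divide field_simps less_le)
qed

lemma form_le_A_numerical_radius:
  assumes B: "B \<in> A_bounded_operators A"
  shows "cmod (A_inner A (B x) x) \<le> A_numerical_radius A B * (snorm x)\<^sup>2"
proof (cases "snorm x = 0")
  \<comment> \<open>Here Cauchy-Schwarz settles the null case.\<close>
  case True
  then show ?thesis using cauchy_schwarz[of "B x" x] by simp
next
  case False
  interpret B: module_hom scaleC scaleC B by (rule A_bounded_module_hom[OF B])
  let ?u = "of_real (1 / snorm x) *\<^sub>C x"
  have "cmod (A_inner A (B ?u) ?u) \<in> {cmod (A_inner A (B x) x) | x. snorm x = 1}"
    using snorm_normalize[OF False] by blast
  then have "cmod (A_inner A (B ?u) ?u) \<le> A_numerical_radius A B"
    using bdd_above_form_values[OF B]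
    by (auto simp: A_numerical_radius_def Sup0_def A_seminorm_eq intro!: cSup_upper)
  then show ?thesis
    using False by (simp add: B.scale form_scale_left form_scale_right norm_mult norm_divide
        field_simps less_le power2_eq_square)
qed

lemma A_opnorm_nonneg:
  assumes "B \<in> A_bounded_operators A"
  shows "0 \<le> A_opnorm A B"
  unfolding A_opnorm_def Sup0_def A_seminorm_eq
  using bdd_above_snorm_values[OF assms] by (auto intro: cSup_upper2)

lemma A_numerical_radius_nonneg:
  assumes "B \<in> A_bounded_operators A"
  shows "0 \<le> A_numerical_radius A B"
  unfolding A_numerical_radius_def Sup0_def A_seminorm_eq
  using bdd_above_form_values[OF assms] by (auto intro: cSup_upper2)

text \<open>A mere estimate is assumed, the form in which the growth of powers is given later;
  \<open>0 \<le> c\<close> settles the empty supremum.\<close>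

lemma A_opnorm_bounds:
  assumes "\<And>x. snorm (B x) \<le> c * snorm x" and "0 \<le> c"
  shows "0 \<le> A_opnorm A B" and "A_opnorm A B \<le> c"
proof -
  have le: "s \<le> c" if "s \<in> {snorm (B x) | x. snorm x = 1}" for s
    using that assms(1) by (auto, metis mult.right_neutral)
  then show "A_opnorm A B \<le> c"
    using assms(2) unfolding A_opnorm_def Sup0_def A_seminorm_eq by (auto intro!: cSup_least)
  have "bdd_above {snorm (B x) | x. snorm x = 1}"
    using le by (rule bdd_aboveI)
  then show "0 \<le> A_opnorm A B"
    unfolding A_opnorm_def Sup0_def A_seminorm_eq by (auto intro: cSup_upper2)
qed

text \<open>The constant is harmless because its roots tend to 1. The shift between
  \<open>Suc n\<close> and \<open>n\<close> matches \<open>funpow_compose_swap\<close>.\<close>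

lemma A_spectral_radius_le:
  assumes w: "w > 0" and K: "K > 0"
    and growth: "\<And>n x. snorm ((R ^^ Suc n) x) \<le> K * w ^ n * snorm x"
  shows "A_spectral_radius A R \<le> w"
proof -
  have bounds: "0 \<le> A_opnorm A (R ^^ Suc n)" "A_opnorm A (R ^^ Suc n) \<le> K * w ^ n" for n
    using A_opnorm_bounds[of "R ^^ Suc n" "K * w ^ n"] growth w K by simp_all
  have "A_spectral_radius A R \<le> root (Suc n) (K / w) * w" for n
  proof -
    have "bdd_below ((\<lambda>n. root n (A_opnorm A (R ^^ n))) ` {1..})"
    proof (rule bdd_belowI2)
      fix m :: nat assume "m \<in> {1..}"
      then show "0 \<le> root m (A_opnorm A (R ^^ m))"
        using bounds(1)[of "m - 1"] by simp
    qed
    then have "A_spectral_radius A R \<le> root (Suc n) (A_opnorm A (R ^^ Suc n))"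
      unfolding A_spectral_radius_def by (rule cINF_lower) simp
    \<comment> \<open>Writing \<open>K * w ^ n\<close> as \<open>K / w * w ^ Suc n\<close> lets the
      root split off exactly \<open>w\<close>.\<close>
    also have "\<dots> \<le> root (Suc n) (K / w * w ^ Suc n)"
      using bounds(2)[of n] w by (intro real_root_le_mono) simp_all
    also have "\<dots> = root (Suc n) (K / w) * w"
      using w by (simp only: real_root_mult real_root_power_cancel less_imp_le zero_less_Suc)
    finally show ?thesis .
  qed
  moreover have "(\<lambda>n. root (Suc n) (K / w) * w) \<longlonglongrightarrow> 1 * w"
    using w K by (intro tendsto_intros LIMSEQ_Suc[OF LIMSEQ_root_const]) simp
  ultimately show ?thesis
    by (intro LIMSEQ_le_const) auto
qed

end

section \<open>Spectral radius of a product through a direct sum\<close>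

text \<open>The carrier consists of all functions on the index type; coordinates outside
  \<open>I\<close> only add null directions, which a degenerate form allows.\<close>

lemma (in complex_semi_inner) direct_sum:
  fixes I :: "'i set"
  shows "complex_semi_inner (\<lambda>c u i. scale c (u i)) (\<lambda>u v. \<Sum>i\<in>I. form (u i) (v i))"
proof (intro complex_semi_inner.intro module.intro complex_semi_inner_axioms.intro)
  show "(\<Sum>i\<in>I. form (u i) (u i)) \<in> \<real>\<^sub>\<ge>\<^sub>0" for u
    using Re_form_nonneg Im_form
    by (simp add: complex_nonneg_Reals_iff sum_nonneg)
qed (simp_all add: fun_eq_iff scale_right_distrib scale_left_distrib form_add_left form_add_right
    form_scale_left form_scale_right sum.distrib sum_distrib_left)

text \<open>Through \<open>L2_set\<close> the seminorm can be compared with single coordinates and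
  with their sum.\<close>

lemma (in complex_semi_inner) direct_sum_snorm:
  "complex_semi_inner.snorm (\<lambda>u v. \<Sum>i\<in>I. form (u i) (v i)) u = L2_set (\<lambda>i. snorm (u i)) I"
  using complex_semi_inner.snorm_def[OF direct_sum, of I u]
  by (simp add: L2_set_def snorm_power2)

text \<open>Regrouping the alternating product leaves one \<open>s\<close> and one \<open>t\<close>
  at the ends, hence the inner power \<open>n\<close>.\<close>

lemma funpow_compose_swap: "((t \<circ> s) ^^ Suc n) x = t (((s \<circ> t) ^^ n) (s x))"
  by (induction n) simp_all

text \<open>Swapping the summations carries each \<open>q j\<close> to its own row; this is the
  origin of the two norms and the factor 1/2 in the final bound.\<close>

lemma symmetrize_off_diagonal_sum:
  fixes a :: "'i \<Rightarrow> 'i \<Rightarrow> real"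
  assumes "finite I"
  shows "(\<Sum>i\<in>I. \<Sum>j\<in>I - {i}. a i j * ((q i + q j) / 2))
    = (\<Sum>i\<in>I. (1 / 2 * (\<Sum>j\<in>I - {i}. a i j + a j i)) * q i)"
proof -
  have "(\<Sum>i\<in>I. \<Sum>j\<in>I - {i}. a i j * q j) = (\<Sum>i\<in>I. \<Sum>j\<in>I - {i}. a j i * q i)"
    using sum.swap_restrict[OF assms assms, of "\<lambda>i j. a i j * q j" "\<lambda>i j. j \<noteq> i"]
    by (simp add: set_diff_eq eq_commute conj_commute)
  then show ?thesis
    by (simp add: sum_distrib_left sum_distrib_right sum.distrib distrib_left distrib_right
        add_divide_distrib flip: sum_divide_distrib)
qed

context positive_form
begin

text \<open>A positive upper bound \<open>w\<close> stands in place of the maximum, because the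
  growth estimates are for \<open>w > 0\<close>.\<close>

lemma A_spectral_radius_sum_compose_le:
  assumes fin: "finite I"
    and T: "\<And>i. i \<in> I \<Longrightarrow> T i \<in> A_bounded_operators A"
    and S: "\<And>i. i \<in> I \<Longrightarrow> S i \<in> A_bounded_operators A"
    and w: "w > 0"
    and bound: "\<And>i. i \<in> I \<Longrightarrow> A_numerical_radius A (S i \<circ> T i)
      + 1 / 2 * (\<Sum>j\<in>I - {i}. A_opnorm A (S i \<circ> T j) + A_opnorm A (S j \<circ> T i)) \<le> w"
  shows "A_spectral_radius A (\<lambda>x. \<Sum>k\<in>I. (T k \<circ> S k) x) \<le> w"
proof -
  interpret D: complex_semi_inner "\<lambda>c u i. c *\<^sub>C u i" "\<lambda>u v. \<Sum>i\<in>I. A_inner A (u i) (v i)"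
    by (rule direct_sum)
  define t where "t u = (\<Sum>j\<in>I. T j (u j))" for u
  \<comment> \<open>Outside \<open>I\<close> the maps \<open>S i\<close> need not be linear, so \<open>s\<close> is cut off there.\<close>
  define s where "s x i = (if i \<in> I then S i x else 0)" for x i
  have T_hom: "module_hom scaleC scaleC (T i)" and S_hom: "module_hom scaleC scaleC (S i)"
    if "i \<in> I" for i
    using A_bounded_module_hom T S that by blast+
  have hom: "module_hom (\<lambda>c u i. c *\<^sub>C u i) (\<lambda>c u i. c *\<^sub>C u i) (s \<circ> t)"
    using T_hom S_hom
    by (auto simp: module_hom_iff D.module_axioms fun_eq_iff s_def t_def sum.distrib
        simp flip: scale_sum_right)
  have num: "cmod (\<Sum>i\<in>I. A_inner A ((s \<circ> t) u i) (u i)) \<le> w * (D.snorm u)\<^sup>2" for u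
  proof -
    define q where "q i = (snorm (u i))\<^sup>2" for i
    have entry: "cmod (A_inner A (S i (T j (u j))) (u i)) \<le> A_opnorm A (S i \<circ> T j) * ((q i + q j) / 2)"
      if "i \<in> I" "j \<in> I" for i j
    proof -
      have ST: "S i \<circ> T j \<in> A_bounded_operators A"
        using that S T by (intro A_bounded_compose)
      have "cmod (A_inner A (S i (T j (u j))) (u i)) \<le> snorm ((S i \<circ> T j) (u j)) * snorm (u i)"
        using cauchy_schwarz by simp
      also have "\<dots> \<le> A_opnorm A (S i \<circ> T j) * snorm (u j) * snorm (u i)"
        by (intro mult_right_mono snorm_le_A_opnorm ST) simp
      also have "\<dots> = A_opnorm A (S i \<circ> T j) * (snorm (u j) * snorm (u i))"
        by simp
      also have "\<dots> \<le> A_opnorm A (S i \<circ> T j) * ((q i + q j) / 2)"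
        using sum_squares_bound[of "snorm (u j)" "snorm (u i)"]
        by (intro mult_left_mono A_opnorm_nonneg ST) (simp add: q_def)
      finally show ?thesis .
    qed
    \<comment> \<open>The diagonal entry is measured by its numerical radius; for the others, which
      pair two different coordinates, \<open>entry\<close> is used.\<close>
    have row: "cmod (A_inner A ((s \<circ> t) u i) (u i)) \<le> A_numerical_radius A (S i \<circ> T i) * q i
        + (\<Sum>j\<in>I - {i}. A_opnorm A (S i \<circ> T j) * ((q i + q j) / 2))" if i: "i \<in> I" for i
    proof -
      interpret S: module_hom scaleC scaleC "S i" by (rule S_hom[OF i])
      have "A_inner A ((s \<circ> t) u i) (u i) = (\<Sum>j\<in>I. A_inner A (S i (T j (u j))) (u i))"
        using i by (simp add: s_def t_def S.sum form_sum_left)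
      also have "\<dots> = A_inner A (S i (T i (u i))) (u i)
          + (\<Sum>j\<in>I - {i}. A_inner A (S i (T j (u j))) (u i))"
        using fin i by (rule sum.remove)
      also have "cmod \<dots> \<le> A_numerical_radius A (S i \<circ> T i) * q i
          + (\<Sum>j\<in>I - {i}. A_opnorm A (S i \<circ> T j) * ((q i + q j) / 2))"
        using form_le_A_numerical_radius[OF A_bounded_compose[OF S[OF i] T[OF i]], of "u i"] i
        by (intro norm_triangle_le add_mono sum_norm_le entry) (simp_all add: q_def)
      finally show ?thesis .
    qed
    have "cmod (\<Sum>i\<in>I. A_inner A ((s \<circ> t) u i) (u i)) \<le> (\<Sum>i\<in>I. A_numerical_radius A (S i \<circ> T i) * q i
        + (\<Sum>j\<in>I - {i}. A_opnorm A (S i \<circ> T j) * ((q i + q j) / 2)))"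
      by (intro sum_norm_le row)
    also have "\<dots> = (\<Sum>i\<in>I. (A_numerical_radius A (S i \<circ> T i)
      + 1 / 2 * (\<Sum>j\<in>I - {i}. A_opnorm A (S i \<circ> T j) + A_opnorm A (S j \<circ> T i))) * q i)"
      unfolding sum.distrib symmetrize_off_diagonal_sum[OF fin] distrib_right ..
    also have "\<dots> \<le> (\<Sum>i\<in>I. w * q i)"
      by (intro sum_mono mult_right_mono bound) (simp_all add: q_def)
    also have "\<dots> = w * (D.snorm u)\<^sup>2"
      by (simp add: q_def direct_sum_snorm L2_set_def sum_nonneg sum_distrib_left)
    finally show ?thesis .
  qed
  \<comment> \<open>Crude bounds suffice for \<open>t\<close> and \<open>s\<close>: \<open>K\<close>
    and \<open>L\<close> affect only the constant factor of the growth estimate.\<close>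
  define K where "K = (\<Sum>i\<in>I. A_opnorm A (T i))"
  define L where "L = (\<Sum>i\<in>I. A_opnorm A (S i))"
  have K: "K \<ge> 0" and L: "L \<ge> 0"
    by (simp_all add: K_def L_def sum_nonneg A_opnorm_nonneg S T)
  have t_bound: "snorm (t u) \<le> K * D.snorm u" for u
  proof -
    have "snorm (t u) \<le> (\<Sum>i\<in>I. snorm (T i (u i)))"
      unfolding t_def by (rule snorm_sum)
    also have "\<dots> \<le> (\<Sum>i\<in>I. A_opnorm A (T i) * D.snorm u)"
    proof (intro sum_mono)
      fix i assume i: "i \<in> I"
      have "snorm (T i (u i)) \<le> A_opnorm A (T i) * snorm (u i)"
        by (intro snorm_le_A_opnorm T i)
      also have "\<dots> \<le> A_opnorm A (T i) * D.snorm u"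
        using member_le_L2_set[OF fin i, of "\<lambda>i. snorm (u i)"]
        by (intro mult_left_mono A_opnorm_nonneg T i) (simp add: direct_sum_snorm)
      finally show "snorm (T i (u i)) \<le> A_opnorm A (T i) * D.snorm u" .
    qed
    finally show ?thesis by (simp add: K_def sum_distrib_right)
  qed
  have s_bound: "D.snorm (s x) \<le> L * snorm x" for x
  proof -
    have "D.snorm (s x) \<le> (\<Sum>i\<in>I. snorm (s x i))"
      unfolding direct_sum_snorm by (intro L2_set_le_sum) simp
    also have "\<dots> \<le> (\<Sum>i\<in>I. A_opnorm A (S i) * snorm x)"
      by (intro sum_mono) (simp add: s_def snorm_le_A_opnorm S)
    finally show ?thesis by (simp add: L_def sum_distrib_right)
  qed
  have R: "(\<lambda>x. \<Sum>k\<in>I. (T k \<circ> S k) x) = t \<circ> s"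
    by (simp add: fun_eq_iff t_def s_def)
  \<comment> \<open>The \<open>+ 1\<close> keeps the constant positive when
    \<open>K * L = 0\<close>, as \<open>A_spectral_radius_le\<close> demands.\<close>
  have "snorm (((t \<circ> s) ^^ Suc n) x) \<le> (2 * K * L + 1) * w ^ n * snorm x" for n x
  proof -
    have "snorm (((t \<circ> s) ^^ Suc n) x) \<le> K * D.snorm (((s \<circ> t) ^^ n) (s x))"
      unfolding funpow_compose_swap by (rule t_bound)
    also have "\<dots> \<le> K * (2 * w ^ n * D.snorm (s x))"
      by (intro mult_left_mono D.snorm_funpow_le hom w num K)
    also have "\<dots> \<le> K * (2 * w ^ n * (L * snorm x))"
      using K w by (intro mult_left_mono s_bound) simp_all
    also have "\<dots> \<le> (2 * K * L + 1) * w ^ n * snorm x"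
      using w by (simp add: algebra_simps)
    finally show ?thesis .
  qed
  then show ?thesis
    unfolding R using w K L by (intro A_spectral_radius_le[where K = "2 * K * L + 1"])
      (simp_all add: add_nonneg_pos)
qed

end

section \<open>Passage from upper bounds to the maximum\<close>

theorem theorem2p7:
  fixes A :: "'a::complex_hilbert_space \<Rightarrow> 'a"
    and T S :: "nat \<Rightarrow> 'a \<Rightarrow> 'a"
    and d :: nat
  assumes "positive_operator A"
    and "d \<ge> 1"
    and "\<And>k. k \<in> {1..d} \<Longrightarrow> T k \<in> A_bounded_operators A"
    and "\<And>k. k \<in> {1..d} \<Longrightarrow> S k \<in> A_bounded_operators A"
  shows "A_spectral_radius A (\<lambda>x. \<Sum>k = 1..d. (T k \<circ> S k) x)
    \<le> Max ((\<lambda>i. A_numerical_radius A (S i \<circ> T i)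
          + 1 / 2 * (\<Sum>j \<in> {1..d} - {i}. A_opnorm A (S i \<circ> T j) + A_opnorm A (S j \<circ> T i)))
        ` {1..d})"
    (is "_ \<le> Max (?f ` _)")
proof -
  interpret positive_form A by standard (rule assms(1))
  have f_le: "?f i \<le> Max (?f ` {1..d})" if "i \<in> {1..d}" for i
    using that by (intro Max_ge) auto
  \<comment> \<open>The index 1 is available because \<open>d \<ge> 1\<close>; the maximum dominates
    this nonnegative value, so every \<open>w\<close> above it is positive.\<close>
  have "0 \<le> ?f 1"
    using assms(2-4)
    by (intro add_nonneg_nonneg mult_nonneg_nonneg sum_nonneg A_numerical_radius_nonneg
        A_opnorm_nonneg A_bounded_compose) auto
  then have nonneg: "0 \<le> Max (?f ` {1..d})"
    by (rule order_trans) (use f_le assms(2) in simp)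
  show ?thesis
  \<comment> \<open>The maximum may be 0, so it is approached by strictly larger \<open>w\<close>,
    for which the estimate is available.\<close>
  proof (rule dense_ge)
    fix w assume w: "Max (?f ` {1..d}) < w"
    show "A_spectral_radius A (\<lambda>x. \<Sum>k = 1..d. (T k \<circ> S k) x) \<le> w"
    proof (rule A_spectral_radius_sum_compose_le)
      show "w > 0" using nonneg w by simp
      show "?f i \<le> w" if "i \<in> {1..d}" for i
        using f_le[OF that] w by simp
    qed (use assms(3,4) in auto)
  qed
qed

end
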